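(* Let $\mathbf{S}=(S;\cdot)$ be a semigroup, and let $$\mathcal{S}=\bigl(\langle\lambda[a,b],\rho[a,b]\rangle\colon I[ab]\to I[a]\times I[b]\bigr)_{(a,b)\in S^2}$$ be a system of sets $(I[s])_{s\in S}$ and maps $\lambda[a,b]\colon I[ab]\to I[a]$, $\rho[a,b]\colon I[ab]\to I[b]$ (for $(a,b)\in S\times S$) indexed by the elements of $S$. Then the following are equivalent. (1) The groupoid $\mathbf{H}^{[\mathcal{S}]}$ is a semigroup, for every semigroup $\mathbf{H}$. (2) $\mathcal{S}$ is a $\lambda\rho$-system over $\mathbf{S}$.
   Context: Composition convention: $(g\circ f)(x)=g(f(x))$. A groupoid here is a set with a binary operation. The sets $I[s]$ may be empty. A system of sets $(I[s])_{s\in S}$ and maps $\lambda[a,b]\colon I[ab]\to I[a]$, $\rho[a,b]\colon I[ab]\to I[b]$ is a $\lambda\rho$-system over $\mathbf{S}$ if for all $a,b,c\in S$: ($\alpha$) $\lambda[a,b]\circ\lambda[ab,c]=\lambda[a,bc]$; ($\beta$) $\rho[b,c]\circ\rho[a,bc]=\rho[ab,c]$; ($\gamma$) $\rho[a,b]\circ\lambda[ab,c]=\lambda[b,c]\circ\rho[a,bc]$. For a semigroup $\mathbf{H}$ (with universe $H$) and any such system $\mathcal{S}$ of sets and maps, $\mathbf{H}^{[\mathcal{S}]}=(H^{[\mathcal{S}]};\star)$ is the groupoid with universe $H^{[\mathcal{S}]}=\{(x,a)\colon a\in S,\ x\in H^{I[a]}\}$, where $H^{I[a]}$ is the set of all maps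 $I[a]\to H$, and operation $$(x,a)\star(y,b)=\bigl((x\circ\lambda[a,b])\cdot(y\circ\rho[a,b]),\ ab\bigr),$$ the product $\cdot$ in the first coordinate being taken pointwise in $H^{I[ab]}$. *)

theory Defs
  imports Main "HOL-Library.FuncSet"
begin

(* A semigroup given by a universe A and an operation of which only the values on A matter.
   The universe is allowed to be empty. *)
locale semigroup_on =
  fixes A :: "'a set" and mult :: "'a \<Rightarrow> 'a \<Rightarrow> 'a"  (infixl "\<cdot>" 70)
  assumes closed: "\<lbrakk>a \<in> A; b \<in> A\<rbrakk> \<Longrightarrow> a \<cdot> b \<in> A"
    and assoc: "\<lbrakk>a \<in> A; b \<in> A; c \<in> A\<rbrakk> \<Longrightarrow> (a \<cdot> b) \<cdot> c = a \<cdot> (b \<cdot> c)"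

locale sets_maps_system =
  fixes S :: "'s set" and mult :: "'s \<Rightarrow> 's \<Rightarrow> 's"  (infixl "\<cdot>" 70)
    and I :: "'s \<Rightarrow> 'i set"
    and lam :: "'s \<Rightarrow> 's \<Rightarrow> 'i \<Rightarrow> 'i"
    and rho :: "'s \<Rightarrow> 's \<Rightarrow> 'i \<Rightarrow> 'i"
  assumes lam_map: "\<lbrakk>a \<in> S; b \<in> S\<rbrakk> \<Longrightarrow> lam a b \<in> I (a \<cdot> b) \<rightarrow> I a"
    and rho_map: "\<lbrakk>a \<in> S; b \<in> S\<rbrakk> \<Longrightarrow> rho a b \<in> I (a \<cdot> b) \<rightarrow> I b"

(* The maps are total HOL functions of which only the values on I (a \<cdot> b) matter, so equality
   of composites is equality at every point of the common domain. *)
locale lambda_rho_system = sets_maps_system +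
  assumes alpha: "\<lbrakk>a \<in> S; b \<in> S; c \<in> S; i \<in> I (a \<cdot> b \<cdot> c)\<rbrakk> \<Longrightarrow>
      (lam a b \<circ> lam (a \<cdot> b) c) i = lam a (b \<cdot> c) i"
    and beta: "\<lbrakk>a \<in> S; b \<in> S; c \<in> S; i \<in> I (a \<cdot> b \<cdot> c)\<rbrakk> \<Longrightarrow>
      (rho b c \<circ> rho a (b \<cdot> c)) i = rho (a \<cdot> b) c i"
    and gamma: "\<lbrakk>a \<in> S; b \<in> S; c \<in> S; i \<in> I (a \<cdot> b \<cdot> c)\<rbrakk> \<Longrightarrow>
      (rho a b \<circ> lam (a \<cdot> b) c) i = (lam b c \<circ> rho a (b \<cdot> c)) i"

(* Elements of H^I[a] are the extensional functions, so that equality of pairs is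
   equality of maps. *)
definition power_universe ::
  "'s set \<Rightarrow> ('s \<Rightarrow> 'i set) \<Rightarrow> 'h set \<Rightarrow> (('i \<Rightarrow> 'h) \<times> 's) set" where
  "power_universe S I H = {(x, a). a \<in> S \<and> x \<in> I a \<rightarrow>\<^sub>E H}"

definition power_mult ::
  "('s \<Rightarrow> 's \<Rightarrow> 's) \<Rightarrow> ('s \<Rightarrow> 'i set) \<Rightarrow> ('s \<Rightarrow> 's \<Rightarrow> 'i \<Rightarrow> 'i) \<Rightarrow> ('s \<Rightarrow> 's \<Rightarrow> 'i \<Rightarrow> 'i) \<Rightarrow>
   ('h \<Rightarrow> 'h \<Rightarrow> 'h) \<Rightarrow> ('i \<Rightarrow> 'h) \<times> 's \<Rightarrow> ('i \<Rightarrow> 'h) \<times> 's \<Rightarrow> ('i \<Rightarrow> 'h) \<times> 's" where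
  "power_mult mS I lam rho mH = (\<lambda>(x, a) (y, b).
     (\<lambda>i\<in>I (mS a b). mH ((x \<circ> lam a b) i) ((y \<circ> rho a b) i), mS a b))"

end

theory Submission imports Defs begin

text \<open>Written out at a point \<open>i\<close> of \<open>I[abc]\<close>, the two bracketings of a product of three
  elements are products of the same three functions, evaluated along the two sides of the
  conditions \<open>\<alpha>\<close>, \<open>\<gamma>\<close>, \<open>\<beta>\<close>. Conversely, take a two-element monoid: when two of the
  three functions are constantly the identity, associativity says that the third takes the same
  value on both sides of one of the conditions, and two-valued functions separate points.\<close>

locale power_system = S: semigroup_on S mS + sets_maps_system S mS I lam rho
  for S :: "'s set" and mS and I :: "'s \<Rightarrow> 'i set" and lam rho
begin

text \<open>Since \<open>lam (mS a b) c\<close> maps into \<open>I (mS a b)\<close>, the inner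
  product is evaluated inside its domain and its restriction drops out.\<close>

lemma power_mult_left:
  assumes "a \<in> S" "b \<in> S" "c \<in> S"
  shows "power_mult mS I lam rho mH (power_mult mS I lam rho mH (x, a) (y, b)) (z, c) =
    (\<lambda>i\<in>I (mS (mS a b) c). mH (mH (x (lam a b (lam (mS a b) c i))) (y (rho a b (lam (mS a b) c i))))
      (z (rho (mS a b) c i)), mS (mS a b) c)"
  using lam_map[of "mS a b" c] assms S.closed[of a b]
  by (auto simp: power_mult_def fun_eq_iff Pi_iff restrict_def)

text \<open>Here \<open>rho a (mS b c)\<close> keeps the inner product inside its domain.
  Associativity of \<open>mS\<close> puts the result over the same index set as in
  \<open>power_mult_left\<close>, so that the bracketings can be compared pointwise.\<close>

lemma power_mult_right:
  assumes "a \<in> S" "b \<in> S" "c \<in> S"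
  shows "power_mult mS I lam rho mH (x, a) (power_mult mS I lam rho mH (y, b) (z, c)) =
    (\<lambda>i\<in>I (mS (mS a b) c). mH (x (lam a (mS b c) i))
      (mH (y (lam b c (rho a (mS b c) i))) (z (rho b c (rho a (mS b c) i)))), mS (mS a b) c)"
  using rho_map[of a "mS b c"] assms S.closed[of b c] S.assoc[of a b c]
  by (auto simp: power_mult_def fun_eq_iff Pi_iff restrict_def)

lemma power_mult_closed:
  assumes "semigroup_on H mH" "p \<in> power_universe S I H" "q \<in> power_universe S I H"
  shows "power_mult mS I lam rho mH p q \<in> power_universe S I H"
proof -
  interpret H: semigroup_on H mH by fact
  obtain x a y b where "p = (x, a)" "q = (y, b)" by fastforce
  with assms(2,3) lam_map[of a b] rho_map[of a b] show ?thesis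
    by (auto simp: power_universe_def power_mult_def Pi_iff PiE_iff S.closed intro!: H.closed)
qed

lemma semigroup_on_power:
  assumes "semigroup_on H mH" and "lambda_rho_system S mS I lam rho"
  shows "semigroup_on (power_universe S I H) (power_mult mS I lam rho mH)"
proof
  interpret H: semigroup_on H mH by fact
  interpret L: lambda_rho_system S mS I lam rho by fact
  fix p q r
  assume "p \<in> power_universe S I H" "q \<in> power_universe S I H" "r \<in> power_universe S I H"
  then obtain x a y b z c where pqr: "p = (x, a)" "q = (y, b)" "r = (z, c)"
    and abc: "a \<in> S" "b \<in> S" "c \<in> S"
    and xyz: "x \<in> I a \<rightarrow> H" "y \<in> I b \<rightarrow> H" "z \<in> I c \<rightarrow> H"
    by (auto simp: power_universe_def PiE_iff Pi_iff)
  have "mH (mH (x (lam a b (lam (mS a b) c i))) (y (rho a b (lam (mS a b) c i))))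
        (z (rho (mS a b) c i)) =
      mH (x (lam a (mS b c) i))
        (mH (y (lam b c (rho a (mS b c) i))) (z (rho b c (rho a (mS b c) i))))"
    if i: "i \<in> I (mS (mS a b) c)" for i
  proof -
    \<comment> \<open>The three values have to lie in \<open>H\<close> before its associativity
      applies; the conditions then match the arguments of \<open>x\<close>, \<open>z\<close> and
      \<open>y\<close>.\<close>
    have ab: "mS a b \<in> S" using abc S.closed by blast
    have l: "lam (mS a b) c i \<in> I (mS a b)" using lam_map[OF ab abc(3)] i by blast
    have "x (lam a b (lam (mS a b) c i)) \<in> H"
      using lam_map[OF abc(1,2)] l xyz(1) by blast
    moreover have "y (rho a b (lam (mS a b) c i)) \<in> H"
      using rho_map[OF abc(1,2)] l xyz(2) by blast
    moreover have "z (rho (mS a b) c i) \<in> H"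
      using rho_map[OF ab abc(3)] i xyz(3) by blast
    ultimately show ?thesis
      using L.alpha[OF abc i] L.beta[OF abc i] L.gamma[OF abc i] by (simp add: H.assoc)
  qed
  then show "power_mult mS I lam rho mH (power_mult mS I lam rho mH p q) r =
      power_mult mS I lam rho mH p (power_mult mS I lam rho mH q r)"
    unfolding pqr power_mult_left[OF abc] power_mult_right[OF abc] by (simp cong: restrict_cong)
qed (rule power_mult_closed[OF assms(1)])

text \<open>Two distinct values in \<open>'h\<close> suffice to build the two-element monoid that
  tests each condition.\<close>

lemma lambda_rho_systemI:
  fixes u v :: 'h
  assumes "u \<noteq> v"
    and power: "\<And>(H :: 'h set) mH. semigroup_on H mH \<Longrightarrow>
      semigroup_on (power_universe S I H) (power_mult mS I lam rho mH)"
  shows "lambda_rho_system S mS I lam rho"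
proof -
  \<comment> \<open>On \<open>{u, v}\<close> this is the monoid with identity \<open>u\<close> and
    absorbing element \<open>v\<close>.\<close>
  define mH where "mH = (\<lambda>p q. if p = u then q else v)"
  have "semigroup_on {u, v} mH"
    by unfold_locales (auto simp: mH_def)
  then interpret P: semigroup_on "power_universe S I {u, v}" "power_mult mS I lam rho mH"
    by (rule power)
  have eq: "mH (mH (x (lam a b (lam (mS a b) c i))) (y (rho a b (lam (mS a b) c i))))
        (z (rho (mS a b) c i)) =
      mH (x (lam a (mS b c) i))
        (mH (y (lam b c (rho a (mS b c) i))) (z (rho b c (rho a (mS b c) i))))"
    if abc: "a \<in> S" "b \<in> S" "c \<in> S" and i: "i \<in> I (mS (mS a b) c)"
      and xyz: "range x \<subseteq> {u, v}" "range y \<subseteq> {u, v}" "range z \<subseteq> {u, v}" for a b c i x y z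
  proof -
    \<comment> \<open>Elements of the universe are extensional, hence the restrictions; they
      disappear below because all six arguments lie in the right index sets.\<close>
    have "(restrict x (I a), a) \<in> power_universe S I {u, v}"
      "(restrict y (I b), b) \<in> power_universe S I {u, v}"
      "(restrict z (I c), c) \<in> power_universe S I {u, v}"
      using abc xyz by (simp_all add: power_universe_def PiE_iff image_subset_iff)
    note A = P.assoc[OF this, unfolded power_mult_left[OF abc] power_mult_right[OF abc] prod.inject,
        THEN conjunct1, THEN fun_cong, of i]
    have ab: "mS a b \<in> S" and bc: "mS b c \<in> S" using abc S.closed by blast+
    have i': "i \<in> I (mS a (mS b c))" using i S.assoc[OF abc] by simp
    have l: "lam (mS a b) c i \<in> I (mS a b)" using lam_map[OF ab abc(3)] i by blast
    have r: "rho a (mS b c) i \<in> I (mS b c)" using rho_map[OF abc(1) bc] i' by blast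
    have "lam a b (lam (mS a b) c i) \<in> I a" "rho a b (lam (mS a b) c i) \<in> I b"
      "rho (mS a b) c i \<in> I c" "lam a (mS b c) i \<in> I a"
      "lam b c (rho a (mS b c) i) \<in> I b" "rho b c (rho a (mS b c) i) \<in> I c"
      using lam_map[OF abc(1,2)] rho_map[OF abc(1,2)] rho_map[OF ab abc(3)]
        lam_map[OF abc(1) bc] lam_map[OF abc(2,3)] rho_map[OF abc(2,3)] i i' l r by blast+
    then show ?thesis using A i by simp
  qed
  \<comment> \<open>The indicator of the point \<open>j\<close>, with \<open>v\<close> for true;
    comparing with its value at \<open>j\<close> detects equality with \<open>j\<close>.\<close>
  define \<chi> where "\<chi> = (\<lambda>j k :: 'i. if k = j then v else u)"
  have \<chi>: "range (\<chi> j) \<subseteq> {u, v}" for j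
    by (auto simp: \<chi>_def)
  have \<chi>_eq: "\<chi> j k = \<chi> j j \<longleftrightarrow> k = j" for j k
    using \<open>u \<noteq> v\<close> by (simp add: \<chi>_def)
  have const: "range (\<lambda>_::'i. u) \<subseteq> {u, v}" by auto
  \<comment> \<open>\<open>u\<close> is a left unit everywhere, but a right unit only on
    \<open>{u, v}\<close>, where the values of \<open>\<chi>\<close> lie.\<close>
  have unit: "mH (\<chi> j k) u = \<chi> j k" "mH u p = p" for j k p
    by (auto simp: \<chi>_def mH_def)
  show ?thesis
  proof
    fix a b c i
    assume abc: "a \<in> S" "b \<in> S" "c \<in> S" and i: "i \<in> I (mS (mS a b) c)"
    note eq = eq[OF abc i]
    show "(lam a b \<circ> lam (mS a b) c) i = lam a (mS b c) i"
      using eq[OF \<chi> const const, of "lam a (mS b c) i"] by (simp add: unit \<chi>_eq)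
    show "(rho b c \<circ> rho a (mS b c)) i = rho (mS a b) c i"
      \<comment> \<open>The test point is now an argument from the left bracketing, so the equation
        arrives reversed and is flipped before \<open>\<chi>_eq\<close> applies.\<close>
      using eq[OF const const \<chi>, of "rho (mS a b) c i"]
      by (simp add: unit \<chi>_eq eq_commute[of "\<chi> j j" for j])
    show "(rho a b \<circ> lam (mS a b) c) i = (lam b c \<circ> rho a (mS b c)) i"
      using eq[OF const \<chi> const, of "lam b c (rho a (mS b c) i)"] by (simp add: unit \<chi>_eq)
  qed
qed

end

theorem theorem1:
  fixes S :: "'s set" and mS :: "'s \<Rightarrow> 's \<Rightarrow> 's"
    and I :: "'s \<Rightarrow> 'i set"
    and lam rho :: "'s \<Rightarrow> 's \<Rightarrow> 'i \<Rightarrow> 'i"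
  assumes "semigroup_on S mS"
    and "sets_maps_system S mS I lam rho"
    and "\<exists>u v :: 'h. u \<noteq> v"
  shows "(\<forall>(H :: 'h set) mH. semigroup_on H mH \<longrightarrow>
            semigroup_on (power_universe S I H) (power_mult mS I lam rho mH))
         \<longleftrightarrow> lambda_rho_system S mS I lam rho"
proof -
  interpret power_system S mS I lam rho
    using assms(1,2) by (rule power_system.intro)
  obtain u v :: 'h where "u \<noteq> v"
    using assms(3) by blast
  then show ?thesis
    using lambda_rho_systemI[of u v] semigroup_on_power by metis
qed

end
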